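(* Let $G\in\mathcal{G}_n^{sc}$ with Hermitian adjacency matrix $A$ and walk-matrix $W=[e,Ae,\ldots,A^{n-1}e]$. Then there exists a permutation matrix $P$ such that $\overline{W}=P^{-1}W$, where $\overline{W}$ is the entrywise complex conjugate. In particular, $\det W$ is real or purely imaginary.
   Context: A mixed graph is obtained from a simple undirected graph by orienting a subset of edges; $\mathcal{G}_n$ is the set of mixed graphs on $[n]$. The Hermitian adjacency matrix $A=(a_{u,v})$ has $a_{u,v}=1$ for an undirected edge $uv$, $i$ for a directed edge $u\to v$, $-i$ for a directed edge $v\to u$, $0$ otherwise. $G$ is self-converse if it is isomorphic to the mixed graph obtained by reversing every directed edge; $\mathcal{G}_n^{sc}$ is the set of self-converse mixed graphs on $[n]$. $e$ is the all-one vector. *)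

theory Defs
  imports Complex_Main
    "HOL-Combinatorics.Permutations"
    "Jordan_Normal_Form.Matrix"
    "Jordan_Normal_Form.Determinant"
begin

text \<open>
  A mixed graph is a simple undirected graph, given by its set of two-element edges,
  together with a partial orientation: \<open>arcs\<close> contains \<open>(u, v)\<close> iff the edge \<open>{u, v}\<close> is
  oriented as \<open>u \<rightarrow> v\<close>. Thus \<open>edges\<close> lists all edges of the underlying graph, and the
  undirected edges of the mixed graph are those left unoriented.
  The vertex set \<open>[n]\<close> is \<open>{0..<n}\<close>, in line with the 0-based matrix indices.
\<close>

record mixed_graph =
  edges :: "nat set set"
  arcs :: "(nat \<times> nat) set"

definition mixed_graphs :: "nat \<Rightarrow> mixed_graph set" where
  "mixed_graphs n =
    {G. edges G \<subseteq> {{u, v} | u v. u < n \<and> v < n \<and> u \<noteq> v} \<and>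
        (\<forall>u v. (u, v) \<in> arcs G \<longrightarrow> {u, v} \<in> edges G \<and> (v, u) \<notin> arcs G)}"

definition converse_graph :: "mixed_graph \<Rightarrow> mixed_graph" where
  "converse_graph G = \<lparr>edges = edges G, arcs = (arcs G)\<inverse>\<rparr>"

definition mixed_graph_iso :: "nat \<Rightarrow> mixed_graph \<Rightarrow> mixed_graph \<Rightarrow> bool" where
  "mixed_graph_iso n G H \<longleftrightarrow>
    (\<exists>f. bij_betw f {0..<n} {0..<n} \<and>
      (\<forall>u<n. \<forall>v<n. ({u, v} \<in> edges G \<longleftrightarrow> {f u, f v} \<in> edges H) \<and>
                    ((u, v) \<in> arcs G \<longleftrightarrow> (f u, f v) \<in> arcs H)))"

definition self_converse_graphs :: "nat \<Rightarrow> mixed_graph set" where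
  "self_converse_graphs n = {G \<in> mixed_graphs n. mixed_graph_iso n G (converse_graph G)}"

definition hermitian_adjacency :: "nat \<Rightarrow> mixed_graph \<Rightarrow> complex mat" where
  "hermitian_adjacency n G = mat n n (\<lambda>(u, v).
     if (u, v) \<in> arcs G then \<i>
     else if (v, u) \<in> arcs G then - \<i>
     else if {u, v} \<in> edges G then 1
     else 0)"

definition all_one_vec :: "nat \<Rightarrow> complex vec" where
  "all_one_vec n = vec n (\<lambda>_. 1)"

definition walk_matrix :: "nat \<Rightarrow> complex mat \<Rightarrow> complex mat" where
  "walk_matrix n A = mat_of_cols n (map (\<lambda>k. (A ^\<^sub>m k) *\<^sub>v all_one_vec n) [0..<n])"

definition permutation_matrix :: "nat \<Rightarrow> complex mat \<Rightarrow> bool" where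
  "permutation_matrix n P \<longleftrightarrow>
    (\<exists>\<pi>. \<pi> permutes {0..<n} \<and> P = mat n n (\<lambda>(i, j). if i = \<pi> j then 1 else 0))"

end

theory Submission
  imports Defs
begin

text \<open>
  An isomorphism \<open>\<pi>\<close> from \<open>G\<close> onto its converse satisfies \<open>A (\<pi> u) (\<pi> v) = cnj (A u v)\<close>. This
  symmetry passes to all powers of \<open>A\<close>, hence to their row sums, which are the entries of \<open>W\<close>; so
  conjugating \<open>W\<close> permutes its rows by \<open>\<pi>\<close>. Taking determinants, \<open>cnj (det W) = \<plusminus> det W\<close>.
\<close>

lemma self_converse_permutation:
  assumes "G \<in> self_converse_graphs n"
  obtains \<pi> where "\<pi> permutes {0..<n}"
    and "\<And>u v. u < n \<Longrightarrow> v < n \<Longrightarrow> {\<pi> u, \<pi> v} \<in> edges G \<longleftrightarrow> {u, v} \<in> edges G"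
    and "\<And>u v. u < n \<Longrightarrow> v < n \<Longrightarrow> (\<pi> u, \<pi> v) \<in> arcs G \<longleftrightarrow> (v, u) \<in> arcs G"
proof -
  obtain f where f: "bij_betw f {0..<n} {0..<n}"
    and fe: "\<And>u v. u < n \<Longrightarrow> v < n \<Longrightarrow> {u, v} \<in> edges G \<longleftrightarrow> {f u, f v} \<in> edges G"
    and fa: "\<And>u v. u < n \<Longrightarrow> v < n \<Longrightarrow> (u, v) \<in> arcs G \<longleftrightarrow> (f v, f u) \<in> arcs G"
    using assms
    by (auto simp: self_converse_graphs_def mixed_graph_iso_def converse_graph_def)
  \<comment> \<open>The bijection \<open>f\<close> is unconstrained outside \<open>{0..<n}\<close>.
    Extending its restriction by the identity makes it a permutation in the sense of
    \<open>permutes\<close>, which the reindexing of sums requires.\<close>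
  define \<pi> where "\<pi> = (\<lambda>x. if x \<in> {0..<n} then f x else x)"
  have "\<pi> permutes {0..<n}"
  proof (rule bij_imp_permutes)
    show "bij_betw \<pi> {0..<n} {0..<n}"
      using f bij_betw_cong[of "{0..<n}" \<pi> f "{0..<n}"] by (simp add: \<pi>_def)
  qed (simp add: \<pi>_def)
  moreover have "{\<pi> u, \<pi> v} \<in> edges G \<longleftrightarrow> {u, v} \<in> edges G" if "u < n" "v < n" for u v
    using fe that by (simp add: \<pi>_def)
  moreover have "(\<pi> u, \<pi> v) \<in> arcs G \<longleftrightarrow> (v, u) \<in> arcs G" if "u < n" "v < n" for u v
    using fa that by (simp add: \<pi>_def)
  ultimately show thesis by (rule that)
qed

lemma hermitian_adjacency_carrier [simp]: "hermitian_adjacency n G \<in> carrier_mat n n"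
  by (simp add: hermitian_adjacency_def)

text \<open>Since \<pi> reverses arcs and preserves edges, it exchanges the entries
  \<open>\<i>\<close> and \<open>- \<i>\<close> and fixes the real entries 1 and 0, just as
  conjugation does.\<close>

lemma hermitian_adjacency_permute:
  assumes "G \<in> mixed_graphs n" and "\<pi> permutes {0..<n}"
    and "{\<pi> u, \<pi> v} \<in> edges G \<longleftrightarrow> {u, v} \<in> edges G"
    and "(\<pi> u, \<pi> v) \<in> arcs G \<longleftrightarrow> (v, u) \<in> arcs G"
    and "(\<pi> v, \<pi> u) \<in> arcs G \<longleftrightarrow> (u, v) \<in> arcs G"
    and "u < n" "v < n"
  shows "hermitian_adjacency n G $$ (\<pi> u, \<pi> v) = cnj (hermitian_adjacency n G $$ (u, v))"
proof -
  have "\<pi> u < n" "\<pi> v < n"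
    using permutes_in_image[OF assms(2)] assms(6,7) by (metis atLeastLessThan_iff zero_le)+
  \<comment> \<open>With arcs in both directions the first branch of the definition would give
    \<open>\<i>\<close> at both positions, which are not conjugate to each other.\<close>
  moreover have "(u, v) \<in> arcs G \<Longrightarrow> (v, u) \<notin> arcs G"
    using assms(1) by (simp add: mixed_graphs_def)
  ultimately show ?thesis
    using assms(3-7) by (auto simp: hermitian_adjacency_def)
qed

text \<open>For the permutation matrix \<open>P\<close> of \<pi> the hypothesis reads
  \<open>P\<^sup>T * A * P = map_mat cnj A\<close>. Conjugation by \<open>P\<close> and
  \<open>cnj\<close> both respect products, so the relation passes to powers; the induction carries
  this out on entries.\<close>

lemma pow_mat_permute_cnj:
  fixes A :: "complex mat"
  assumes A: "A \<in> carrier_mat n n" and \<pi>: "\<pi> permutes {0..<n}"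
    and cnj: "\<And>u v. u < n \<Longrightarrow> v < n \<Longrightarrow> A $$ (\<pi> u, \<pi> v) = cnj (A $$ (u, v))"
    and "u < n" "v < n"
  shows "(A ^\<^sub>m k) $$ (\<pi> u, \<pi> v) = cnj ((A ^\<^sub>m k) $$ (u, v))"
  using \<open>u < n\<close> \<open>v < n\<close>
proof (induction k arbitrary: u v)
  case 0
  have "\<pi> u < n" "\<pi> v < n"
    using permutes_in_image[OF \<pi>] 0 by (metis atLeastLessThan_iff zero_le)+
  moreover have "\<pi> u = \<pi> v \<longleftrightarrow> u = v"
    using permutes_inj[OF \<pi>] by (auto dest: injD)
  ultimately show ?case
    using 0 A by simp
next
  case (Suc k)
  have Ak: "A ^\<^sub>m k \<in> carrier_mat n n"
    using A by simp
  have lt: "\<pi> u < n" "\<pi> v < n"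
    using permutes_in_image[OF \<pi>] Suc.prems by (metis atLeastLessThan_iff zero_le)+
  have "(A ^\<^sub>m Suc k) $$ (\<pi> u, \<pi> v) = (\<Sum>w\<in>{0..<n}. (A ^\<^sub>m k) $$ (\<pi> u, w) * A $$ (w, \<pi> v))"
    using A Ak lt by (simp add: scalar_prod_def)
  \<comment> \<open>The intermediate index \<open>w\<close> runs over all of \<open>{0..<n}\<close>,
    so it may be replaced by \<open>\<pi> w\<close>; now the induction hypothesis applies to the
    first factor and \<open>cnj\<close> to the second.\<close>
  also have "\<dots> = (\<Sum>w\<in>{0..<n}. (A ^\<^sub>m k) $$ (\<pi> u, \<pi> w) * A $$ (\<pi> w, \<pi> v))"
    by (subst sum.permute[OF \<pi>]) (simp add: o_def)
  also have "\<dots> = (\<Sum>w\<in>{0..<n}. cnj ((A ^\<^sub>m k) $$ (u, w) * A $$ (w, v)))"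
    using Suc cnj by (intro sum.cong) auto
  also have "\<dots> = cnj ((A ^\<^sub>m Suc k) $$ (u, v))"
    using A Ak Suc.prems by (simp add: scalar_prod_def)
  finally show ?case .
qed

lemma walk_matrix_carrier [simp]: "walk_matrix n A \<in> carrier_mat n n"
  by (simp add: walk_matrix_def mat_of_cols_def)

lemma walk_matrix_index:
  assumes "A \<in> carrier_mat n n" "u < n" "k < n"
  shows "walk_matrix n A $$ (u, k) = (\<Sum>v\<in>{0..<n}. (A ^\<^sub>m k) $$ (u, v))"
proof -
  have "A ^\<^sub>m k \<in> carrier_mat n n"
    using assms by simp
  then show ?thesis
    using assms
    by (simp add: walk_matrix_def mat_of_cols_def all_one_vec_def scalar_prod_def)
qed

text \<open>Only the row index is permuted: the all-one vector is invariant under \<pi>, so a row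
  sum of a power of \<open>A\<close> can be reindexed by \<pi> while the exponent \<open>k\<close>
  stays fixed.\<close>

lemma walk_matrix_permute_cnj:
  assumes A: "A \<in> carrier_mat n n" and \<pi>: "\<pi> permutes {0..<n}"
    and cnj: "\<And>u v. u < n \<Longrightarrow> v < n \<Longrightarrow> A $$ (\<pi> u, \<pi> v) = cnj (A $$ (u, v))"
    and u: "u < n" and k: "k < n"
  shows "walk_matrix n A $$ (\<pi> u, k) = cnj (walk_matrix n A $$ (u, k))"
proof -
  have "\<pi> u < n"
    using permutes_in_image[OF \<pi>] u by (metis atLeastLessThan_iff zero_le)
  then have "walk_matrix n A $$ (\<pi> u, k) = (\<Sum>v\<in>{0..<n}. (A ^\<^sub>m k) $$ (\<pi> u, v))"
    using walk_matrix_index[OF A _ k] by simp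
  also have "\<dots> = (\<Sum>v\<in>{0..<n}. (A ^\<^sub>m k) $$ (\<pi> u, \<pi> v))"
    by (subst sum.permute[OF \<pi>]) (simp add: o_def)
  also have "\<dots> = (\<Sum>v\<in>{0..<n}. cnj ((A ^\<^sub>m k) $$ (u, v)))"
    using pow_mat_permute_cnj[OF A \<pi> cnj] u by (intro sum.cong) auto
  also have "\<dots> = cnj (walk_matrix n A $$ (u, k))"
    using walk_matrix_index[OF A u k] by simp
  finally show ?thesis .
qed

text \<open>Row \<open>i\<close> of the transpose has its single 1 at position
  \<open>\<pi> i\<close>, which is below \<open>n\<close>, so the product picks out row
  \<open>\<pi> i\<close> of \<open>M\<close>.\<close>

lemma permutation_matrix_transpose_mult:
  fixes M :: "'a :: comm_ring_1 mat"
  assumes \<pi>: "\<pi> permutes {0..<n}" and M: "M \<in> carrier_mat n m"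
  shows "(mat n n (\<lambda>(i, j). if i = \<pi> j then 1 else 0))\<^sup>T * M = mat n m (\<lambda>(i, j). M $$ (\<pi> i, j))"
proof (rule eq_matI)
  fix i j assume "i < dim_row (mat n m (\<lambda>(i, j). M $$ (\<pi> i, j)))"
    and "j < dim_col (mat n m (\<lambda>(i, j). M $$ (\<pi> i, j)))"
  then have ij: "i < n" "j < m" by auto
  have "\<pi> i < n"
    using permutes_in_image[OF \<pi>] ij by (metis atLeastLessThan_iff zero_le)
  then show "((mat n n (\<lambda>(i, j). if i = \<pi> j then 1 else 0))\<^sup>T * M) $$ (i, j)
      = mat n m (\<lambda>(i, j). M $$ (\<pi> i, j)) $$ (i, j)"
    using ij M by (simp add: scalar_prod_def if_distrib[of "\<lambda>x. x * _"] sum.delta cong: if_cong)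
qed (use M in auto)

lemma permutation_matrix_transpose_inverse:
  fixes n :: nat and \<pi> :: "nat \<Rightarrow> nat"
  defines "P \<equiv> mat n n (\<lambda>(i, j). if i = \<pi> j then 1 else 0) :: 'a :: field mat"
  assumes \<pi>: "\<pi> permutes {0..<n}"
  shows "P\<^sup>T * P = 1\<^sub>m n" and "P * P\<^sup>T = 1\<^sub>m n"
proof -
  have P: "P \<in> carrier_mat n n"
    by (simp add: P_def)
  have "\<pi> i < n" if "i < n" for i
    using permutes_in_image[OF \<pi>] that by (metis atLeastLessThan_iff zero_le)
  moreover have "\<pi> i = \<pi> j \<longleftrightarrow> i = j" for i j
    using permutes_inj[OF \<pi>] by (auto dest: injD)
  \<comment> \<open>Row selection is applied to \<open>P\<close> itself: the entry at
    \<open>(\<pi> i, j)\<close> is 1 exactly when \<open>\<pi> i = \<pi> j\<close>, and injectivity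
    turns this into the identity matrix.\<close>
  ultimately have "mat n n (\<lambda>(i, j). P $$ (\<pi> i, j)) = 1\<^sub>m n"
    by (intro eq_matI) (auto simp: P_def)
  then show *: "P\<^sup>T * P = 1\<^sub>m n"
    using permutation_matrix_transpose_mult[OF \<pi> P] by (simp add: P_def)
  show "P * P\<^sup>T = 1\<^sub>m n"
    using mat_mult_left_right_inverse[OF _ P *] P by simp
qed

text \<open>The determinant is a polynomial in the entries with integer coefficients, so it commutes
  with every ring homomorphism.\<close>

lemma det_map_mat_cnj: "det (map_mat cnj M) = cnj (det M)"
proof -
  interpret comm_ring_hom cnj
    by unfold_locales auto
  show ?thesis by (rule hom_det)
qed

theorem theorem6:
  fixes n :: nat and G :: mixed_graph and A W :: "complex mat"
  assumes "G \<in> self_converse_graphs n"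
    and "A = hermitian_adjacency n G"
    and "W = walk_matrix n A"
  shows "(\<exists>P Pinv. permutation_matrix n P \<and>
            inverts_mat P Pinv \<and> inverts_mat Pinv P \<and>
            map_mat cnj W = Pinv * W) \<and>
         (det W \<in> \<real> \<or> Re (det W) = 0)"
proof -
  obtain \<pi> where \<pi>: "\<pi> permutes {0..<n}"
    and edges: "\<And>u v. u < n \<Longrightarrow> v < n \<Longrightarrow> {\<pi> u, \<pi> v} \<in> edges G \<longleftrightarrow> {u, v} \<in> edges G"
    and arcs: "\<And>u v. u < n \<Longrightarrow> v < n \<Longrightarrow> (\<pi> u, \<pi> v) \<in> arcs G \<longleftrightarrow> (v, u) \<in> arcs G"
    by (rule self_converse_permutation[OF assms(1)]) blast
  have G: "G \<in> mixed_graphs n"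
    using assms(1) by (simp add: self_converse_graphs_def)
  have A: "A \<in> carrier_mat n n" and W: "W \<in> carrier_mat n n"
    by (simp_all add: assms(2,3))
  have A_cnj: "A $$ (\<pi> u, \<pi> v) = cnj (A $$ (u, v))" if "u < n" "v < n" for u v
    unfolding assms(2)
    by (rule hermitian_adjacency_permute[OF G \<pi>]) (use that edges arcs in simp_all)
  define P :: "complex mat" where "P = mat n n (\<lambda>(i, j). if i = \<pi> j then 1 else 0)"
  have P: "P \<in> carrier_mat n n"
    by (simp add: P_def)
  have inv: "P\<^sup>T * P = 1\<^sub>m n" "P * P\<^sup>T = 1\<^sub>m n"
    unfolding P_def by (rule permutation_matrix_transpose_inverse[OF \<pi>])+
  \<comment> \<open>The transpose serves as the inverse of \<open>P\<close>: left multiplication by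
    it sends row \<open>\<pi> u\<close> of \<open>W\<close> to position \<open>u\<close>, where the
    conjugate of row \<open>u\<close> is wanted.\<close>
  have W_cnj: "map_mat cnj W = P\<^sup>T * W"
    unfolding P_def permutation_matrix_transpose_mult[OF \<pi> W]
    using W walk_matrix_permute_cnj[OF A \<pi> A_cnj, folded assms(3)] by (intro eq_matI) auto
  have "permutation_matrix n P"
    using \<pi> by (auto simp: permutation_matrix_def P_def)
  then have perm: "\<exists>P Pinv. permutation_matrix n P \<and> inverts_mat P Pinv \<and> inverts_mat Pinv P \<and>
      map_mat cnj W = Pinv * W"
    using inv W_cnj P by (intro exI[of _ P] exI[of _ "P\<^sup>T"]) (simp add: inverts_mat_def)
  \<comment> \<open>Determinants of \<open>P\<^sup>T * P = 1\<^sub>m n\<close>, where transposing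
    leaves the determinant unchanged; this makes the sign of \<pi> available without computing
    it.\<close>
  have "det P * det P = 1"
    using det_mult[of "P\<^sup>T" n P] P by (simp add: inv det_transpose[OF P])
  then have "det P = 1 \<or> det P = - 1"
    by (simp add: square_eq_1_iff)
  moreover have "cnj (det W) = det P * det W"
    using det_mult[of "P\<^sup>T" n W] P W
    by (simp add: det_map_mat_cnj[symmetric] W_cnj det_transpose[OF P])
  ultimately have "cnj (det W) = det W \<or> cnj (det W) = - det W"
    by auto
  then have "det W \<in> \<real> \<or> Re (det W) = 0"
    by (auto simp: Reals_cnj_iff complex_eq_iff)
  with perm show ?thesis by blast
qed

end
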